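(* Let $\mathcal H$ be a real Hilbert space; let $f,g,h$ be proper closed convex functions on $\mathcal H$ with $h$ differentiable and $\nabla h$ $(1/\beta)$-Lipschitz, $\beta>0$; let $\overline A,\overline B:\mathcal H\to\mathcal H$ be bounded skew linear maps ($\overline A^\ast=-\overline A$, $\overline B^\ast=-\overline B$). Let $A=\partial f+\overline A$ and $B=\partial g+\overline B$ be maximal monotone and $C=\nabla h$. Let $\varepsilon\in(0,1)$, $\gamma\in(0,2\beta\varepsilon)$, $\alpha=1/(2-\varepsilon)$, $(\lambda_j)_{j\ge0}\subseteq(0,1/\alpha]$. Let $T:=I_{\mathcal H}-J_{\gamma B}+J_{\gamma A}\circ(2J_{\gamma B}-I_{\mathcal H}-\gamma C\circ J_{\gamma B})$ have a fixed point $z^\ast$, and let $x^\ast=J_{\gamma B}(z^\ast)$. Let $z^0\in\mathcal H$, $z^{k+1}=(1-\lambda_k)z^k+\lambda_kTz^k$, $x_B^k:=J_{\gamma B}(z^k)$, $x_A^k:=J_{\gamma A}(2x_B^k-z^k-\gamma Cx_B^k)$, and $$\overline x_A^k=\frac1{\sum_{i=0}^k\lambda_i}\sum_{i=0}^k\lambda_ix_A^i,\qquad\overline x_B^k=\frac1{\sum_{i=0}^k\lambda_i}\sum_{i=0}^k\lambda_ix_B^i.$$ Then: 1. For all $k\ge0$ and $x\in\mathrm{dom}(f)\cap\mathrm{dom}(g)$, $$\begin{aligned}&f(\overline x_A^k)+g(\overline x_B^k)+h(\overline x_B^k)-(f+g+h)(x)+\langle-x,\overline A\,\overline x_B^k+\overline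 B\,\overline x_B^k\rangle\\&\le\frac{\|z^0-x\|^2+\frac{\gamma}{2\beta\varepsilon-\gamma}\|z^0-z^\ast\|^2+4\gamma\|z^0-z^\ast\|\,\|Cx^\ast\|+4\gamma\|\overline A\|\,\|x\|\,\|z^0-z^\ast\|}{2\gamma\sum_{i=0}^k\lambda_i}.\end{aligned}$$ 2. Suppose $f$ is $L_f$-Lipschitz continuous on the closed ball of center $x^\ast$ and radius $(1+\gamma/\beta)\|z^0-z^\ast\|$. Then for all $k\ge0$ and $x\in\mathrm{dom}(f)\cap\mathrm{dom}(g)$, $$\begin{aligned}&f(\overline x_B^k)+g(\overline x_B^k)+h(\overline x_B^k)-(f+g+h)(x)+\langle-x,\overline A\,\overline x_B^k+\overline B\,\overline x_B^k\rangle\\&\le\frac{\|z^0-x\|^2+\frac{\gamma}{2\beta\varepsilon-\gamma}\|z^0-z^\ast\|^2+4\gamma\|z^0-z^\ast\|\,\|Cx^\ast\|+4\gamma\|\overline A\|\,\|x\|\,\|z^0-z^\ast\|+4\gamma L_f\|z^0-z^\ast\|}{2\gamma\sum_{i=0}^k\lambda_i}.\end{aligned}$$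
   Context: $J_S:=(I_{\mathcal H}+S)^{-1}$ is the resolvent of a maximal monotone operator $S$; $\partial$ is the convex subdifferential; $\|\overline A\|$ is the operator norm. *)

theory Defs
  imports "HOL-Analysis.Analysis"
begin

definition ext_epigraph :: "('a \<Rightarrow> ereal) \<Rightarrow> ('a \<times> real) set" where
  "ext_epigraph f = {(x, r). f x \<le> ereal r}"

definition ext_dom :: "('a \<Rightarrow> ereal) \<Rightarrow> 'a set" where
  "ext_dom f = {x. f x < \<infinity>}"

definition proper_closed_convex :: "('a::real_normed_vector \<Rightarrow> ereal) \<Rightarrow> bool" where
  "proper_closed_convex f \<longleftrightarrow>
     (\<forall>x. f x \<noteq> -\<infinity>) \<and> ext_dom f \<noteq> {} \<and>
     closed (ext_epigraph f) \<and> convex (ext_epigraph f)"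

(* For proper f the set is empty at any x outside ext_dom f: there f x = \<infinity>, and the
   inequality fails at every y in ext_dom f. *)
definition subdifferential :: "('a::real_inner \<Rightarrow> ereal) \<Rightarrow> 'a \<Rightarrow> 'a set" where
  "subdifferential f x = {u. \<forall>y. f x + ereal (inner (y - x) u) \<le> f y}"

(* Lipschitz continuity of an extended-real-valued function on S includes finiteness on S. *)
definition ext_lipschitz_on :: "real \<Rightarrow> 'a::metric_space set \<Rightarrow> ('a \<Rightarrow> ereal) \<Rightarrow> bool" where
  "ext_lipschitz_on L S f \<longleftrightarrow>
     (\<forall>x\<in>S. \<bar>f x\<bar> \<noteq> \<infinity>) \<and> L-lipschitz_on S (\<lambda>x. real_of_ereal (f x))"

text \<open>Set-valued operators are maps \<open>S :: 'a \<Rightarrow> 'a set\<close>.\<close>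

definition monotone_operator :: "('a::real_inner \<Rightarrow> 'a set) \<Rightarrow> bool" where
  "monotone_operator S \<longleftrightarrow>
     (\<forall>x y. \<forall>u\<in>S x. \<forall>v\<in>S y. 0 \<le> inner (x - y) (u - v))"

definition maximal_monotone :: "('a::real_inner \<Rightarrow> 'a set) \<Rightarrow> bool" where
  "maximal_monotone S \<longleftrightarrow>
     monotone_operator S \<and>
     (\<forall>S'. monotone_operator S' \<and> (\<forall>x. S x \<subseteq> S' x) \<longrightarrow> S' = S)"

definition op_add :: "('a::plus \<Rightarrow> 'a set) \<Rightarrow> ('a \<Rightarrow> 'a set) \<Rightarrow> 'a \<Rightarrow> 'a set" where
  "op_add R S x = {u + v | u v. u \<in> R x \<and> v \<in> S x}"

definition op_scale :: "real \<Rightarrow> ('a::real_vector \<Rightarrow> 'a set) \<Rightarrow> 'a \<Rightarrow> 'a set" where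
  "op_scale c S x = (\<lambda>u. c *\<^sub>R u) ` S x"

(* The value at z of the inverse of I + S, i.e. the point x with z \<in> (I + S) x.
   For maximal monotone S on a Hilbert space this point exists and is unique for
   every z (Minty); otherwise the description may be meaningless. *)
definition resolvent :: "('a::real_inner \<Rightarrow> 'a set) \<Rightarrow> 'a \<Rightarrow> 'a" where
  "resolvent S z = (THE x. z \<in> op_add (\<lambda>y. {y}) S x)"

end

theory Submission
  imports Defs
begin

text \<open>The resolvents exist because a minimising sequence of a strongly convex function is Cauchy,
  which gives the proximal map, and a Banach contraction absorbs the skew part. (The Riesz
  representation, needed to see that \<open>adjoint\<close> is a genuine adjoint on a Hilbert space, is the
  proximal map of a linear functional.)

  With \<open>d = x\<^sub>A - x\<^sub>B = T z - z\<close>, monotonicity of \<open>A\<close> and \<open>B\<close> and cocoercivity of \<open>C\<close> make the distance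
  of \<open>z\<^sup>k\<close> to \<open>z\<^sup>*\<close> decrease by enough to control \<open>\<Sum> \<lambda>\<^sub>i \<parallel>C x\<^sub>B\<^sup>i - C x\<^sup>*\<parallel>\<^sup>2\<close>. The subgradient
  inequalities at \<open>x\<^sub>A\<close> and \<open>x\<^sub>B\<close> bound \<open>2 \<gamma> \<lambda>\<^sub>k\<close> times the gap by a telescoping expression plus
  \<open>2 \<gamma> \<langle>z\<^sup>k - z\<^sup>k\<^sup>+\<^sup>1, C x\<^sub>B\<rangle>\<close>; writing \<open>C x\<^sub>B = (C x\<^sub>B - C x\<^sup>*) + C x\<^sup>*\<close>, the first part is absorbed
  by Young's inequality and the second one telescopes. Jensen's inequality passes to the averages,
  and \<open>\<Sum> \<lambda>\<^sub>i (x\<^sub>A\<^sup>i - x\<^sub>B\<^sup>i) = z\<^sup>k\<^sup>+\<^sup>1 - z\<^sup>0\<close> has norm at most \<open>2 \<parallel>z\<^sup>0 - z\<^sup>*\<parallel>\<close>, which accounts for the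
  terms in \<open>\<parallel>A\<parallel>\<close> and \<open>L\<^sub>f\<close>.\<close>

section \<open>Proximal maps and resolvents\<close>

lemma convex_midpoint:
  assumes "convex S" "x \<in> S" "y \<in> S"
  shows "(1/2) *\<^sub>R (x + y) \<in> S"
  using convexD[OF assms, of "1/2" "1/2"] by (simp add: scaleR_add_right)

lemma proper_finite:
  assumes "proper_closed_convex f" "x \<in> ext_dom f"
  shows "f x = ereal (real_of_ereal (f x))"
  using assms by (cases "f x") (auto simp: proper_closed_convex_def ext_dom_def)

lemma proper_le_iff:
  assumes "proper_closed_convex f"
  shows "f x \<le> ereal r \<longleftrightarrow> x \<in> ext_dom f \<and> real_of_ereal (f x) \<le> r"
  using assms by (cases "f x") (auto simp: proper_closed_convex_def ext_dom_def)

lemma proper_convex_on: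
  assumes f: "proper_closed_convex f"
  shows "convex_on (ext_dom f) (\<lambda>x. real_of_ereal (f x))"
proof -
  have *: "u *\<^sub>R x + v *\<^sub>R y \<in> ext_dom f \<and>
      real_of_ereal (f (u *\<^sub>R x + v *\<^sub>R y)) \<le> u * real_of_ereal (f x) + v * real_of_ereal (f y)"
    if "x \<in> ext_dom f" "y \<in> ext_dom f" "0 \<le> u" "0 \<le> v" "u + v = 1" for x y u v
  proof -
    have "convex (ext_epigraph f)"
      using f by (simp add: proper_closed_convex_def)
    from convexD[OF this, of "(x, real_of_ereal (f x))" "(y, real_of_ereal (f y))" u v]
    have "f (u *\<^sub>R x + v *\<^sub>R y) \<le> ereal (u * real_of_ereal (f x) + v * real_of_ereal (f y))"
      using that by (simp add: ext_epigraph_def proper_le_iff[OF f])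
    then show ?thesis by (simp only: proper_le_iff[OF f])
  qed
  show ?thesis
    unfolding convex_on_def using * by (auto intro!: convexI)
qed

text \<open>The subgradient inequality at one point of the domain forces \<open>f x\<close> to be
  finite; the condition then becomes one between reals on \<open>ext_dom f\<close> and is trivial
  outside it.\<close>

lemma subdifferential_iff:
  assumes f: "proper_closed_convex f"
  shows "u \<in> subdifferential f x \<longleftrightarrow> x \<in> ext_dom f \<and>
    (\<forall>y\<in>ext_dom f. real_of_ereal (f x) + inner (y - x) u \<le> real_of_ereal (f y))"
    (is "?L \<longleftrightarrow> ?R")
proof
  assume L: ?L
  obtain y0 where y0: "y0 \<in> ext_dom f"
    using f by (auto simp: proper_closed_convex_def)
  have le: "f x + ereal (inner (y - x) u) \<le> f y" for y
    using L by (simp add: subdifferential_def)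
  have x: "x \<in> ext_dom f"
    using le[of y0] y0 by (cases "f x") (auto simp: ext_dom_def)
  moreover have "real_of_ereal (f x) + inner (y - x) u \<le> real_of_ereal (f y)" if "y \<in> ext_dom f" for y
  proof -
    have "ereal (real_of_ereal (f x)) + ereal (inner (y - x) u) \<le> ereal (real_of_ereal (f y))"
      using le[of y] proper_finite[OF f x] proper_finite[OF f that] by simp
    then show ?thesis by simp
  qed
  ultimately show ?R by blast
next
  assume R: ?R
  then have x: "x \<in> ext_dom f" by blast
  have "f x + ereal (inner (y - x) u) \<le> f y" for y
  proof (cases "y \<in> ext_dom f")
    case True
    then have "ereal (real_of_ereal (f x)) + ereal (inner (y - x) u) \<le> ereal (real_of_ereal (f y))"
      using R by simp
    then show ?thesis
      using proper_finite[OF f x] proper_finite[OF f True] by simp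
  next
    case False
    then show ?thesis by (simp add: ext_dom_def)
  qed
  then show ?L by (simp add: subdifferential_def)
qed

lemma subdifferential_monotone:
  assumes f: "proper_closed_convex f"
    and "u \<in> subdifferential f x" "v \<in> subdifferential f y"
  shows "0 \<le> inner (x - y) (u - v)"
proof -
  have "real_of_ereal (f x) + inner (y - x) u \<le> real_of_ereal (f y)"
    "real_of_ereal (f y) + inner (x - y) v \<le> real_of_ereal (f x)"
    using assms(2,3) by (auto simp: subdifferential_iff[OF f])
  then show ?thesis by (simp add: inner_simps)
qed

text \<open>The point \<open>(y0, F y0 - 1)\<close> lies off the closed epigraph, so
  \<open>F\<close> stays above \<open>F y0 - 1\<close> on a small ball. A point \<open>y\<close>
  farther away is pulled along the segment to the sphere of radius \<open>r\<close>, and convexity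
  carries the bound back to \<open>y\<close>.\<close>

lemma proper_lower_bound:
  assumes f: "proper_closed_convex f"
  obtains y0 r b where "r > 0" "\<And>y. y \<in> ext_dom f \<Longrightarrow> b - norm (y - y0) / r \<le> real_of_ereal (f y)"
proof -
  obtain y0 where y0: "y0 \<in> ext_dom f"
    using f by (auto simp: proper_closed_convex_def)
  define F where "F y = real_of_ereal (f y)" for y
  have cl: "open (- ext_epigraph f)"
    using f by (auto simp: proper_closed_convex_def)
  have "(y0, F y0 - 1) \<in> - ext_epigraph f"
    by (auto simp: ext_epigraph_def proper_le_iff[OF f] F_def)
  then obtain U V where UV: "open U" "y0 \<in> U" "F y0 - 1 \<in> V" "U \<times> V \<subseteq> - ext_epigraph f"
    using open_prod_elim[OF cl, of "(y0, F y0 - 1)"] by (metis mem_Times_iff fst_conv snd_conv)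
  then obtain r where r: "r > 0" "cball y0 r \<subseteq> U"
    by (meson open_contains_cball)
  have near: "F y0 - 1 < F y" if "y \<in> ext_dom f" "norm (y - y0) \<le> r" for y
  proof -
    have "y \<in> U"
      using r that by (auto simp: dist_norm norm_minus_commute)
    then have "(y, F y0 - 1) \<notin> ext_epigraph f"
      using UV by auto
    then show ?thesis
      using that by (auto simp: ext_epigraph_def proper_le_iff[OF f] F_def)
  qed
  have "(F y0 - 1) - norm (y - y0) / r \<le> F y" if y: "y \<in> ext_dom f" for y
  proof (cases "norm (y - y0) \<le> r")
    case True
    then show ?thesis using near[OF y] r(1)
      by (smt (verit) divide_nonneg_pos norm_ge_zero)
  next
    case False
    define t where "t = r / norm (y - y0)"
    have "0 < norm (y - y0)" using False r(1) by linarith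
    then have ne: "y \<noteq> y0" by simp
    have t: "0 < t" "t \<le> 1"
      using False r(1) ne by (simp_all add: t_def divide_le_eq_1)
    define w where "w = (1 - t) *\<^sub>R y0 + t *\<^sub>R y"
    have "norm (w - y0) = r"
    proof -
      have "w - y0 = t *\<^sub>R (y - y0)" by (simp add: w_def algebra_simps)
      then show ?thesis using ne r(1) by (simp add: t_def)
    qed
    moreover have "w \<in> ext_dom f" "F w \<le> (1 - t) * F y0 + t * F y"
      using proper_convex_on[OF f] y0 y t
      by (auto simp: convex_on_def w_def F_def intro: convexD)
    ultimately have "F y0 - 1 < (1 - t) * F y0 + t * F y"
      using near[of w] by linarith
    then have "t * F y0 - 1 < t * F y" by (simp add: algebra_simps)
    then have "F y0 - 1 / t < F y" using t by (simp add: field_simps)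
    then show ?thesis by (simp add: t_def)
  qed
  then show ?thesis using r(1) that[of r "F y0 - 1" y0] by (simp add: F_def)
qed

text \<open>The point \<open>p\<close> is the minimiser of \<open>\<Phi>\<close>, and the claim is
  its first-order optimality condition.\<close>

lemma ex_prox:
  fixes f :: "'a::{real_inner, complete_space} \<Rightarrow> ereal"
  assumes f: "proper_closed_convex f" and c: "0 < c"
  shows "\<exists>p. (1 / c) *\<^sub>R (z - p) \<in> subdifferential f p"
proof -
  define F where "F y = real_of_ereal (f y)" for y
  define \<Phi> where "\<Phi> y = c * F y + (norm (y - z))\<^sup>2 / 2" for y
  define D where "D = ext_dom f"
  have cvx: "convex_on D F" using proper_convex_on[OF f] by (simp add: D_def F_def[abs_def])
  have D: "D \<noteq> {}" "convex D"
    using f cvx by (auto simp: proper_closed_convex_def D_def convex_on_def)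
  obtain y0 r b where r: "r > 0" "\<And>y. y \<in> D \<Longrightarrow> b - norm (y - y0) / r \<le> F y"
    using proper_lower_bound[OF f] unfolding D_def F_def by metis
  \<comment> \<open>The quadratic term outweighs the at most linear decrease of \<open>F\<close>:
    \<open>- (c / r)\<^sup>2 / 2\<close> is the minimum over \<open>s\<close> of
    \<open>s\<^sup>2 / 2 - c * s / r\<close>.\<close>
  have "c * (b - norm (z - y0) / r) - (c / r)\<^sup>2 / 2 \<le> \<Phi> y" if y: "y \<in> D" for y
  proof -
    define s where "s = norm (y - z)"
    have "norm (y - y0) \<le> s + norm (z - y0)"
      unfolding s_def using norm_triangle_ineq[of "y - z" "z - y0"] by simp
    then have "norm (y - y0) / r \<le> (s + norm (z - y0)) / r"
      using r by (intro divide_right_mono) auto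
    then have "b - norm (z - y0) / r - s / r \<le> F y"
      using r(2)[OF y] by (simp add: add_divide_distrib)
    then have "c * (b - norm (z - y0) / r - s / r) \<le> c * F y"
      using c by simp
    moreover have "(c / r)\<^sup>2 / 2 + s\<^sup>2 / 2 - c * (s / r) = (c / r - s)\<^sup>2 / 2"
      by (simp add: power2_diff diff_divide_distrib add_divide_distrib)
    moreover have "0 \<le> (c / r - s)\<^sup>2 / 2" by simp
    ultimately have "c * (b - norm (z - y0) / r) - (c / r)\<^sup>2 / 2 \<le> c * F y + s\<^sup>2 / 2"
      unfolding right_diff_distrib by linarith
    then show ?thesis
      unfolding \<Phi>_def s_def .
  qed
  then have bdd: "bdd_below (\<Phi> ` D)" by (auto intro!: bdd_belowI)
  define m where "m = Inf (\<Phi> ` D)"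
  have m_le: "m \<le> \<Phi> y" if "y \<in> D" for y
    unfolding m_def using bdd that by (intro cInf_lower) auto
  have "\<exists>y\<in>D. \<Phi> y < m + inverse (real (Suc n))" for n
    using cInf_lessD[of "\<Phi> ` D" "m + inverse (real (Suc n))"] D by (auto simp: m_def)
  then obtain Y where Y: "\<And>n. Y n \<in> D" "\<And>n. \<Phi> (Y n) < m + inverse (real (Suc n))"
    by metis
  \<comment> \<open>The parallelogram law at the midpoint: near-minimisers of \<open>\<Phi>\<close>
    are near each other.\<close>
  have close: "(norm (x - y))\<^sup>2 \<le> 4 * (\<Phi> x - m + (\<Phi> y - m))" if "x \<in> D" "y \<in> D" for x y
  proof -
    let ?w = "(1/2) *\<^sub>R (x + y)"
    have w: "?w \<in> D" using convex_midpoint D(2) that by blast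
    have "F ?w \<le> (1/2) * F x + (1/2) * F y"
      using convex_onD[OF cvx, of "1/2" x y] that by (simp add: scaleR_add_right)
    then have "c * F ?w \<le> c * ((1/2) * F x + (1/2) * F y)" using c by simp
    moreover have "(norm (?w - z))\<^sup>2 = (norm (x - z))\<^sup>2 / 2 + (norm (y - z))\<^sup>2 / 2 - (norm (x - y))\<^sup>2 / 4"
      unfolding power2_norm_eq_inner by (simp add: inner_simps inner_commute field_simps)
    ultimately show ?thesis
      using m_le[OF w] unfolding \<Phi>_def by (simp add: algebra_simps)
  qed
  have "Cauchy Y"
  proof (rule metric_CauchyI)
    fix e :: real assume e: "e > 0"
    obtain N where N: "inverse (real (Suc N)) < e\<^sup>2 / 8"
      using reals_Archimedean[of "e\<^sup>2 / 8"] e by auto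
    have "dist (Y i) (Y j) < e" if "i \<ge> N" "j \<ge> N" for i j
    proof -
      have "inverse (real (Suc i)) \<le> inverse (real (Suc N))" "inverse (real (Suc j)) \<le> inverse (real (Suc N))"
        using that by (auto intro!: le_imp_inverse_le)
      then have "(norm (Y i - Y j))\<^sup>2 < e\<^sup>2"
        using close[OF Y(1)[of i] Y(1)[of j]] Y(2)[of i] Y(2)[of j] N by argo
      then show ?thesis
        using e power_less_imp_less_base[of "norm (Y i - Y j)" 2 e] by (simp add: dist_norm)
    qed
    then show "\<exists>M. \<forall>i\<ge>M. \<forall>j\<ge>M. dist (Y i) (Y j) < e" by blast
  qed
  then obtain p where p: "Y \<longlonglongrightarrow> p" using Cauchy_convergent convergent_def by blast
  \<comment> \<open>\<open>R n\<close> bounds \<open>F (Y n)\<close> from above and converges, so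
    closedness of the epigraph alone gives both \<open>p \<in> D\<close> and
    \<open>\<Phi> p \<le> m\<close>.\<close>
  define R where "R n = (m + inverse (real (Suc n)) - (norm (Y n - z))\<^sup>2 / 2) / c" for n
  have "R \<longlonglongrightarrow> (m + 0 - (norm (p - z))\<^sup>2 / 2) / c"
    unfolding R_def by (intro tendsto_intros p LIMSEQ_inverse_real_of_nat) (use c in auto)
  then have "(\<lambda>n. (Y n, R n)) \<longlonglongrightarrow> (p, (m - (norm (p - z))\<^sup>2 / 2) / c)"
    using p by (auto intro: tendsto_Pair)
  moreover have "(Y n, R n) \<in> ext_epigraph f" for n
  proof -
    have "F (Y n) * c \<le> m + inverse (real (Suc n)) - (norm (Y n - z))\<^sup>2 / 2"
      using Y(2)[of n] by (simp add: \<Phi>_def mult.commute)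
    then have "F (Y n) \<le> R n" using c by (simp add: R_def pos_le_divide_eq)
    then show ?thesis
      using Y(1)[of n] by (simp add: ext_epigraph_def proper_le_iff[OF f] D_def F_def)
  qed
  moreover have "closed (ext_epigraph f)" using f by (simp add: proper_closed_convex_def)
  ultimately have "(p, (m - (norm (p - z))\<^sup>2 / 2) / c) \<in> ext_epigraph f"
    using closed_sequentially[of "ext_epigraph f" "\<lambda>n. (Y n, R n)"] by simp
  then have p: "p \<in> D" "\<Phi> p \<le> m"
    using c by (simp_all add: ext_epigraph_def proper_le_iff[OF f] \<Phi>_def D_def F_def
        pos_le_divide_eq mult.commute[of c])
  have "F p + inner (y - p) ((1 / c) *\<^sub>R (z - p)) \<le> F y" if y: "y \<in> D" for y
  proof -
    define q where "q = inner (y - p) (z - p)"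
    define n where "n = (norm (y - p))\<^sup>2"
    \<comment> \<open>Minimality of \<open>p\<close> is tested against a point at fraction
      \<open>t\<close> of the way to \<open>y\<close>; after division by \<open>t\<close>, the
      quadratic remainder vanishes as \<open>t\<close> tends to 0.\<close>
    have key: "q \<le> c * (F y - F p) + (t / 2) * n" if t: "0 < t" "t \<le> 1" for t
    proof -
      let ?w = "(1 - t) *\<^sub>R p + t *\<^sub>R y"
      have w: "?w \<in> D" using convexD[OF D(2) p(1) y] t by simp
      have "F ?w \<le> (1 - t) * F p + t * F y"
        using cvx t p y unfolding convex_on_def by simp
      then have "c * F ?w \<le> c * ((1 - t) * F p + t * F y)" using c by simp
      moreover have "(norm (?w - z))\<^sup>2 = (norm (p - z))\<^sup>2 - 2 * t * q + t\<^sup>2 * n"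
        unfolding power2_norm_eq_inner q_def n_def
        by (simp add: inner_simps inner_commute algebra_simps power2_eq_square)
      ultimately have "0 \<le> t * (c * (F y - F p) - q + (t / 2) * n)"
        using m_le[OF w] p(2) unfolding \<Phi>_def by (simp add: algebra_simps power2_eq_square)
      then show ?thesis using t by (simp add: zero_le_mult_iff)
    qed
    have "((\<lambda>t. c * (F y - F p) + (t / 2) * n) \<longlongrightarrow> c * (F y - F p) + (0 / 2) * n) (at_right 0)"
      by (intro tendsto_intros) auto
    moreover have "\<forall>\<^sub>F t in at_right (0::real). q \<le> c * (F y - F p) + (t / 2) * n"
      unfolding eventually_at_right_field using key by (intro exI[of _ 1]) auto
    ultimately have "q \<le> c * (F y - F p)"
      using tendsto_lowerbound[OF _ _ trivial_limit_at_right_real] by fastforce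
    then have "q / c \<le> F y - F p" using c by (simp add: pos_divide_le_eq mult.commute)
    then show ?thesis by (simp add: q_def)
  qed
  then show ?thesis
    unfolding subdifferential_iff[OF f] using p(1) by (auto simp: D_def F_def)
qed

section \<open>Riesz representation and skew adjoints\<close>

lemma riesz_representation:
  fixes \<phi> :: "'a::{real_inner, complete_space} \<Rightarrow> real"
  assumes "bounded_linear \<phi>"
  shows "\<exists>p. \<forall>v. \<phi> v = inner v p"
proof -
  interpret bounded_linear \<phi> by fact
  define f where "f x = ereal (- \<phi> x)" for x
  have "ext_epigraph f = {w. - \<phi> (fst w) \<le> snd w}"
    by (auto simp: ext_epigraph_def f_def)
  moreover have "closed {w::'a \<times> real. - \<phi> (fst w) \<le> snd w}"
    by (intro closed_Collect_le continuous_intros continuous_on)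
  moreover have "convex {w::'a \<times> real. - \<phi> (fst w) \<le> snd w}"
  proof (rule convexI)
    fix w w' :: "'a \<times> real" and u v :: real
    assume "w \<in> {w. - \<phi> (fst w) \<le> snd w}" "w' \<in> {w. - \<phi> (fst w) \<le> snd w}" "0 \<le> u" "0 \<le> v"
    then have "u * (- \<phi> (fst w)) \<le> u * snd w" "v * (- \<phi> (fst w')) \<le> v * snd w'"
      using mult_left_mono by blast+
    then show "u *\<^sub>R w + v *\<^sub>R w' \<in> {w. - \<phi> (fst w) \<le> snd w}"
      by (simp add: add scale)
  qed
  ultimately have f: "proper_closed_convex f"
    by (auto simp: proper_closed_convex_def f_def ext_dom_def)
  obtain p where p: "0 - p \<in> subdifferential f p"
    using ex_prox[OF f, of 1 0] by auto
  have *: "- \<phi> p + inner (y - p) (0 - p) \<le> - \<phi> y" for y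
    using p unfolding subdifferential_def f_def by (simp only: mem_Collect_eq plus_ereal.simps ereal_less_eq)
  \<comment> \<open>A subgradient of a linear functional represents it: steps \<open>v\<close> and
    \<open>- v\<close> from \<open>p\<close> give the two inequalities.\<close>
  have "\<phi> v = inner v p" for v
    using *[of "p + v"] *[of "p - v"] by (simp add: add diff inner_simps)
  then show ?thesis by blast
qed

text \<open>\<open>adjoint\<close> is defined by choice; Riesz representation supplies a witness, so
  the chosen map has the defining property.\<close>

lemma adjoint_works_hilbert:
  fixes L :: "'a::{real_inner, complete_space} \<Rightarrow> 'b::real_inner"
  assumes "bounded_linear L"
  shows "inner (L x) y = inner x (adjoint L y)"
proof -
  have "\<exists>p. \<forall>v. inner (L v) y = inner v p" for y
    by (intro riesz_representation bounded_linear_inner_left_comp assms)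
  then have "\<exists>L'. \<forall>x y. inner (L x) y = inner x (L' y)" by metis
  then show ?thesis
    unfolding adjoint_def by (rule someI2_ex) blast
qed

lemma skew_inner_self:
  fixes L :: "'a::{real_inner, complete_space} \<Rightarrow> 'a"
  assumes "bounded_linear L" "adjoint L = (\<lambda>x. - L x)"
  shows "inner x (L x) = 0"
  using adjoint_works_hilbert[OF assms(1), of x x] assms(2) by (simp add: inner_commute)

section \<open>Resolvents of a subdifferential plus a skew map\<close>

lemma subdifferential_add_skew_monotone:
  assumes f: "proper_closed_convex f"
    and L: "bounded_linear L" "\<And>x. inner x (L x) = 0"
  shows "monotone_operator (op_add (subdifferential f) (\<lambda>x. {L x}))"
proof -
  interpret bounded_linear L by fact
  have "0 \<le> inner (x - y) (u + L x - (v + L y))"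
    if "u \<in> subdifferential f x" "v \<in> subdifferential f y" for x y u v
    using subdifferential_monotone[OF f that] L(2)[of "x - y"]
    by (simp add: diff inner_simps)
  then show ?thesis
    by (auto simp: monotone_operator_def op_add_def)
qed

text \<open>With \<open>P\<close> the proximal map of \<open>c f\<close> and \<open>t = c / \<gamma>\<close>, the inclusion reads
  \<open>x = P (t z + (1 - t) x - c L x)\<close>. Skewness makes the two summands of
  \<open>(1 - t) x - c L x\<close> orthogonal, so this is a contraction for \<open>t = 1 / (1 + \<gamma>\<^sup>2 K\<^sup>2)\<close>.\<close>

lemma ex_resolvent_subdifferential_add_skew:
  fixes f :: "'a::{real_inner, complete_space} \<Rightarrow> ereal"
  assumes f: "proper_closed_convex f"
    and L: "bounded_linear L" "\<And>x. inner x (L x) = 0"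
    and \<gamma>: "0 < \<gamma>"
  shows "\<exists>x. \<exists>u\<in>op_add (subdifferential f) (\<lambda>x. {L x}) x. z = x + \<gamma> *\<^sub>R u"
proof -
  interpret bounded_linear L by fact
  obtain K where K: "\<And>x. norm (L x) \<le> norm x * K" using bounded by blast
  define t where "t = 1 / (1 + \<gamma>\<^sup>2 * K\<^sup>2)"
  have pos: "0 < 1 + \<gamma>\<^sup>2 * K\<^sup>2" by (simp add: add_pos_nonneg)
  then have t: "0 < t" "t \<le> 1" by (auto simp: t_def)
  define c where "c = t * \<gamma>"
  have c: "0 < c" using t \<gamma> by (simp add: c_def)
  have "\<forall>w. \<exists>p. (1 / c) *\<^sub>R (w - p) \<in> subdifferential f p"
    using ex_prox[OF f c] by blast
  then obtain P where P: "\<And>w. (1 / c) *\<^sub>R (w - P w) \<in> subdifferential f (P w)"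
    by metis
  have P_nonexp: "norm (P w - P w') \<le> norm (w - w')" for w w'
  proof -
    have "0 \<le> inner (P w - P w') ((1 / c) *\<^sub>R (w - P w) - (1 / c) *\<^sub>R (w' - P w'))"
      using subdifferential_monotone[OF f P P] .
    then have "0 \<le> (1 / c) * inner (P w - P w') ((w - w') - (P w - P w'))"
      by (simp add: inner_simps algebra_simps)
    then have "0 \<le> inner (P w - P w') ((w - w') - (P w - P w'))"
      using c by (simp add: zero_le_divide_iff)
    then have "(norm (P w - P w'))\<^sup>2 \<le> inner (P w - P w') (w - w')"
      by (simp add: inner_diff_right power2_norm_eq_inner)
    also have "\<dots> \<le> norm (P w - P w') * norm (w - w')" by (rule norm_cauchy_schwarz)
    finally show ?thesis
      by (cases "norm (P w - P w') = 0") (auto simp: power2_eq_square)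
  qed
  define G where "G x = P (t *\<^sub>R z + (1 - t) *\<^sub>R x - c *\<^sub>R L x)" for x
  have "dist (G x) (G y) \<le> sqrt (1 - t) * dist x y" for x y
  proof -
    define d where "d = x - y"
    have "(norm ((1 - t) *\<^sub>R d - c *\<^sub>R L d))\<^sup>2 = (1 - t)\<^sup>2 * (norm d)\<^sup>2 + c\<^sup>2 * (norm (L d))\<^sup>2"
      unfolding power2_norm_eq_inner using L(2)[of d]
      by (simp add: inner_simps inner_commute power2_eq_square algebra_simps)
    also have "\<dots> \<le> (1 - t)\<^sup>2 * (norm d)\<^sup>2 + c\<^sup>2 * (norm d * K)\<^sup>2"
      using K[of d] by (intro add_left_mono mult_left_mono power_mono) auto
    also have "\<dots> = (1 - 2 * t + t * (t * (1 + \<gamma>\<^sup>2 * K\<^sup>2))) * (norm d)\<^sup>2"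
      by (simp add: c_def power2_eq_square algebra_simps)
    \<comment> \<open>The choice of \<open>t\<close> collapses the factor to
      \<open>1 - 2 * t + t = 1 - t\<close>, which is below 1.\<close>
    also have "t * (1 + \<gamma>\<^sup>2 * K\<^sup>2) = 1" using pos by (simp add: t_def)
    finally have "(norm ((1 - t) *\<^sub>R d - c *\<^sub>R L d))\<^sup>2 \<le> (sqrt (1 - t) * norm d)\<^sup>2"
      using t by (simp add: power_mult_distrib)
    then have *: "norm ((1 - t) *\<^sub>R d - c *\<^sub>R L d) \<le> sqrt (1 - t) * norm d"
      by (rule power2_le_imp_le) (use t in auto)
    have "norm (G x - G y) \<le> norm ((1 - t) *\<^sub>R d - c *\<^sub>R L d)"
      unfolding G_def by (rule order_trans[OF P_nonexp]) (simp add: d_def diff algebra_simps)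
    with * show ?thesis by (simp add: dist_norm d_def)
  qed
  then obtain x where x: "G x = x"
    using banach_fix_type[of "sqrt (1 - t)" G] t by auto
  define u where "u = (1 / c) *\<^sub>R (t *\<^sub>R z + (1 - t) *\<^sub>R x - c *\<^sub>R L x - x)"
  have u: "u \<in> subdifferential f x"
    using P[of "t *\<^sub>R z + (1 - t) *\<^sub>R x - c *\<^sub>R L x"] x unfolding u_def G_def by simp
  have "\<gamma> *\<^sub>R u = (1 / t) *\<^sub>R (t *\<^sub>R z - t *\<^sub>R x - c *\<^sub>R L x)"
    using \<gamma> t unfolding u_def c_def by (simp add: algebra_simps)
  also have "\<dots> = z - x - \<gamma> *\<^sub>R L x"
    using t by (simp add: c_def scaleR_diff_right)
  finally have "z = x + \<gamma> *\<^sub>R (u + L x)" by (simp add: algebra_simps)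
  then show ?thesis
    using u unfolding op_add_def by blast
qed

text \<open>Monotonicity gives the uniqueness that \<open>THE\<close> demands: two solutions satisfy
  \<open>x - y = \<gamma> *\<^sub>R (v - u)\<close>, so that
  \<open>0 \<le> - \<gamma> * inner (u - v) (u - v)\<close>.\<close>

lemma resolvent_eqI:
  assumes M: "monotone_operator M" and \<gamma>: "0 < \<gamma>" and u: "u \<in> M x"
  shows "resolvent (op_scale \<gamma> M) (x + \<gamma> *\<^sub>R u) = x"
  unfolding resolvent_def
proof (rule the_equality)
  show "x + \<gamma> *\<^sub>R u \<in> op_add (\<lambda>y. {y}) (op_scale \<gamma> M) x"
    using u by (auto simp: op_add_def op_scale_def)
  fix y assume "x + \<gamma> *\<^sub>R u \<in> op_add (\<lambda>y. {y}) (op_scale \<gamma> M) y"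
  then obtain v where v: "v \<in> M y" "x + \<gamma> *\<^sub>R u = y + \<gamma> *\<^sub>R v"
    by (auto simp: op_add_def op_scale_def)
  have "0 \<le> inner (x - y) (u - v)"
    using M u v by (auto simp: monotone_operator_def)
  moreover have "x - y = \<gamma> *\<^sub>R (v - u)" using v(2) by (simp add: algebra_simps)
  then have "inner (x - y) (u - v) = - \<gamma> * inner (u - v) (u - v)"
    by (simp only:) (simp add: inner_diff_left inner_diff_right inner_commute algebra_simps)
  ultimately have "\<gamma> * inner (u - v) (u - v) \<le> 0" by simp
  then have "inner (u - v) (u - v) \<le> 0" using \<gamma> by (simp add: mult_le_0_iff)
  then have "u = v" using inner_ge_zero[of "u - v"] by (metis antisym inner_eq_zero_iff right_minus_eq)
  then show "y = x" using v(2) by simp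
qed

lemma resolvent_subdifferential_add_skew:
  fixes f :: "'a::{real_inner, complete_space} \<Rightarrow> ereal"
  assumes f: "proper_closed_convex f"
    and L: "bounded_linear L" "\<And>x. inner x (L x) = 0"
    and \<gamma>: "0 < \<gamma>"
    and x: "x = resolvent (op_scale \<gamma> (op_add (subdifferential f) (\<lambda>x. {L x}))) w"
  shows "\<exists>u\<in>subdifferential f x. \<gamma> *\<^sub>R (u + L x) = w - x"
proof -
  let ?M = "op_add (subdifferential f) (\<lambda>x. {L x})"
  obtain y v where "v \<in> ?M y" "w = y + \<gamma> *\<^sub>R v"
    using ex_resolvent_subdifferential_add_skew[OF f L \<gamma>, of w] by blast
  moreover from this have "x = y"
    using resolvent_eqI[OF subdifferential_add_skew_monotone[OF f L] \<gamma>] x by blast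
  ultimately show ?thesis by (auto simp: op_add_def)
qed

text \<open>This is monotonicity of the operator, scaled by \<open>\<gamma>\<close>. The form
  \<open>0 \<le> inner d (e - d)\<close>, with output difference \<open>d\<close> and input
  difference \<open>e\<close>, is the one that the splitting estimates take as hypothesis.\<close>

lemma resolvent_firmly_nonexpansive:
  fixes f :: "'a::{real_inner, complete_space} \<Rightarrow> ereal"
  assumes f: "proper_closed_convex f"
    and L: "bounded_linear L" "\<And>x. inner x (L x) = 0"
    and \<gamma>: "0 < \<gamma>"
    and x: "x = resolvent (op_scale \<gamma> (op_add (subdifferential f) (\<lambda>x. {L x}))) w"
    and y: "y = resolvent (op_scale \<gamma> (op_add (subdifferential f) (\<lambda>x. {L x}))) v"
  shows "0 \<le> inner (x - y) (w - v - (x - y))"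
proof -
  obtain a where a: "a \<in> subdifferential f x" "\<gamma> *\<^sub>R (a + L x) = w - x"
    using resolvent_subdifferential_add_skew[OF f L \<gamma> x] by blast
  obtain b where b: "b \<in> subdifferential f y" "\<gamma> *\<^sub>R (b + L y) = v - y"
    using resolvent_subdifferential_add_skew[OF f L \<gamma> y] by blast
  have "0 \<le> inner (x - y) ((a + L x) - (b + L y))"
    using subdifferential_add_skew_monotone[OF f L] a(1) b(1)
    by (auto simp: monotone_operator_def op_add_def)
  then have "0 \<le> inner (x - y) (\<gamma> *\<^sub>R (a + L x) - \<gamma> *\<^sub>R (b + L y))"
    using \<gamma> by (simp flip: scaleR_diff_right)
  then show ?thesis
    unfolding a b by (simp add: algebra_simps)
qed

text \<open>The reflection satisfies \<open>(norm (2 *\<^sub>R d - e))\<^sup>2 = (norm e)\<^sup>2 -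
  4 * inner d (e - d)\<close>, and \<open>d\<close> is the mean of \<open>2 *\<^sub>R d - e\<close>
  and \<open>e\<close>. Both bounds serve to confine the iterates to the Lipschitz ball.\<close>

lemma firmly_nonexpansive_norm_le:
  fixes d e :: "'a::real_inner"
  assumes "0 \<le> inner d (e - d)"
  shows "norm d \<le> norm e" "norm (2 *\<^sub>R d - e) \<le> norm e"
proof -
  have "(norm (2 *\<^sub>R d - e))\<^sup>2 = (norm e)\<^sup>2 - 4 * inner d (e - d)"
    unfolding power2_norm_eq_inner by (simp add: inner_diff_left inner_diff_right inner_commute)
  then show refl: "norm (2 *\<^sub>R d - e) \<le> norm e"
    using assms by (intro power2_le_imp_le[OF _ norm_ge_zero]) simp
  have "norm (2 *\<^sub>R d) \<le> norm (2 *\<^sub>R d - e) + norm e"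
    using norm_triangle_ineq[of "2 *\<^sub>R d - e" e] by simp
  then show "norm d \<le> norm e" using refl by simp
qed

section \<open>Gradients of convex functions\<close>

lemma GDERIV_line:
  assumes "GDERIV h (x + t *\<^sub>R d) :> c"
  shows "((\<lambda>s. h (x + s *\<^sub>R d)) has_real_derivative inner d c) (at t)"
proof -
  have "((\<lambda>s. h (x + s *\<^sub>R d)) has_derivative (\<lambda>s. inner (s *\<^sub>R d) c)) (at t)"
    using assms unfolding gderiv_def
    by (rule has_derivative_compose[rotated]) (auto intro!: derivative_eq_intros)
  then show ?thesis
    by (simp add: has_field_derivative_def mult_commute_abs)
qed

text \<open>On the line through \<open>x\<close> and \<open>y\<close> this is the tangent inequality
  for a convex function of one real variable.\<close>

lemma convex_gradient_le:
  assumes h: "convex_on UNIV h" and c: "GDERIV h x :> c"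
  shows "h x + inner (y - x) c \<le> h y"
proof -
  define \<phi> where "\<phi> t = h (x + t *\<^sub>R (y - x))" for t :: real
  have "convex_on UNIV \<phi>"
    unfolding convex_on_def
  proof (intro conjI ballI allI impI convex_UNIV)
    fix a b u v :: real assume uv: "0 \<le> u" "0 \<le> v" "u + v = 1"
    have "x + (u *\<^sub>R a + v *\<^sub>R b) *\<^sub>R (y - x) =
        (u + v) *\<^sub>R x + (u *\<^sub>R a + v *\<^sub>R b) *\<^sub>R (y - x)"
      using uv by simp
    also have "\<dots> = u *\<^sub>R (x + a *\<^sub>R (y - x)) + v *\<^sub>R (x + b *\<^sub>R (y - x))"
      by (simp only: scaleR_add_right scaleR_add_left scaleR_scaleR real_scaleR_def add_ac)
    finally show "\<phi> (u *\<^sub>R a + v *\<^sub>R b) \<le> u * \<phi> a + v * \<phi> b"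
      using h uv unfolding \<phi>_def convex_on_def by simp
  qed
  moreover have "(\<phi> has_real_derivative inner (y - x) c) (at 0)"
    unfolding \<phi>_def using c by (intro GDERIV_line) simp
  ultimately have "\<phi> 1 - \<phi> 0 \<ge> inner (y - x) c * (1 - 0)"
    by (intro convex_on_imp_above_tangent[of UNIV]) auto
  then show ?thesis by (simp add: \<phi>_def)
qed

text \<open>\<open>\<psi>\<close> is \<open>h\<close> along the segment minus its linear and
  quadratic model terms; the Lipschitz bound makes its derivative nonpositive.\<close>

lemma descent_lemma:
  assumes C: "\<And>x. GDERIV h x :> C x" and lip: "K-lipschitz_on UNIV C"
  shows "h (x + d) \<le> h x + inner d (C x) + K / 2 * (norm d)\<^sup>2"
proof -
  define \<psi> where "\<psi> t = h (x + t *\<^sub>R d) - t * inner d (C x) - K / 2 * t\<^sup>2 * (norm d)\<^sup>2" for t :: real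
  have "\<psi> 1 \<le> \<psi> 0"
  proof (rule DERIV_nonpos_imp_nonincreasing[of 0 1 \<psi>])
    fix t :: real assume t: "0 \<le> t" "t \<le> 1"
    let ?D = "inner d (C (x + t *\<^sub>R d)) - inner d (C x) - K * t * (norm d)\<^sup>2"
    have "(\<psi> has_real_derivative ?D) (at t)"
      unfolding \<psi>_def by (rule derivative_eq_intros GDERIV_line[OF C] refl | simp)+
    moreover have "?D \<le> 0"
    proof -
      have "inner d (C (x + t *\<^sub>R d) - C x) \<le> norm d * norm (C (x + t *\<^sub>R d) - C x)"
        by (rule norm_cauchy_schwarz)
      also have "\<dots> \<le> norm d * (K * norm (t *\<^sub>R d))"
        using lipschitz_onD[OF lip, of "x + t *\<^sub>R d" x]
        by (intro mult_left_mono) (auto simp: dist_norm)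
      also have "\<dots> = K * t * (norm d)\<^sup>2" using t by (simp add: power2_eq_square)
      finally show ?thesis by (simp add: inner_diff_right)
    qed
    ultimately show "\<exists>y. (\<psi> has_real_derivative y) (at t) \<and> y \<le> 0" by blast
  qed simp
  then show ?thesis by (simp add: \<psi>_def)
qed

text \<open>Baillon--Haddad: apply the gradient inequality at \<open>y\<close> and the descent lemma at \<open>x\<close> to the
  point reached from \<open>x\<close> by a gradient step for \<open>h - \<langle>\<cdot>, C y\<rangle>\<close>.\<close>

lemma convex_gradient_cocoercive:
  fixes C :: "'a::real_inner \<Rightarrow> 'a"
  assumes h: "convex_on UNIV h" and C: "\<And>x. GDERIV h x :> C x"
    and \<beta>: "0 < \<beta>" and lip: "(1 / \<beta>)-lipschitz_on UNIV C"
  shows "\<beta> * (norm (C x - C y))\<^sup>2 \<le> inner (x - y) (C x - C y)"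
proof -
  have *: "h y + inner (x - y) (C y) + \<beta> / 2 * (norm (C x - C y))\<^sup>2 \<le> h x" for x y
  proof -
    define n where "n = (norm (C x - C y))\<^sup>2"
    define d where "d = (- \<beta>) *\<^sub>R (C x - C y)"
    have "h y + inner (x + d - y) (C y) \<le> h (x + d)"
      by (rule convex_gradient_le[OF h C])
    also have "\<dots> \<le> h x + inner d (C x) + (1 / \<beta>) / 2 * (norm d)\<^sup>2"
      by (rule descent_lemma[OF C lip])
    finally have "h y + inner (x - y) (C y) \<le> h x + inner d (C x - C y) + (1 / \<beta>) / 2 * (norm d)\<^sup>2"
      by (simp add: inner_simps)
    moreover have "inner d (C x - C y) = - \<beta> * n"
      unfolding d_def n_def power2_norm_eq_inner by simp
    moreover have "(1 / \<beta>) / 2 * (norm d)\<^sup>2 = \<beta> / 2 * n"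
      using \<beta> unfolding d_def n_def by (simp add: power_mult_distrib power2_eq_square)
    ultimately show ?thesis by (simp add: n_def)
  qed
  \<comment> \<open>Adding the inequality to its copy with \<open>x\<close> and \<open>y\<close>
    swapped cancels the values of \<open>h\<close> and doubles \<open>\<beta> / 2\<close>.\<close>
  show ?thesis
    using *[of x y] *[of y x] by (simp add: inner_simps norm_minus_commute)
qed

text \<open>Jensen's inequality, multiplied by the total weight to match the summed estimates.
  Membership gives finiteness of the functions at the averages and, with a zero function, places the
  averages in a ball.\<close>

lemma convex_on_weighted_average:
  fixes l :: "nat \<Rightarrow> real"
  assumes \<phi>: "convex_on D \<phi>" and y: "\<And>i. y i \<in> D" and l: "\<And>i. 0 < l i"
    and w: "w = (1 / (\<Sum>i\<le>k. l i)) *\<^sub>R (\<Sum>i\<le>k. l i *\<^sub>R y i)"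
  shows "w \<in> D" "(\<Sum>i\<le>k. l i) * \<phi> w \<le> (\<Sum>i\<le>k. l i * \<phi> (y i))"
proof -
  define S where "S = (\<Sum>i\<le>k. l i)"
  have S: "0 < S" unfolding S_def by (rule sum_pos) (use l in auto)
  have w': "w = (\<Sum>i\<le>k. (l i / S) *\<^sub>R y i)"
    by (simp add: w S_def[symmetric] scaleR_sum_right)
  have wt: "(\<Sum>i\<le>k. l i / S) = 1" "\<And>i. 0 \<le> l i / S"
    using S l by (simp_all add: S_def flip: sum_divide_distrib) (simp add: less_imp_le)
  show "w \<in> D"
    unfolding w' using \<phi> y wt by (intro convex_sum) (auto simp: convex_on_def)
  have "\<phi> w \<le> (\<Sum>i\<le>k. l i / S * \<phi> (y i))"
    unfolding w' using \<phi> y wt by (intro convex_on_sum) auto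
  also have "\<dots> = (\<Sum>i\<le>k. l i * \<phi> (y i)) / S"
    by (simp add: sum_divide_distrib)
  finally show "(\<Sum>i\<le>k. l i) * \<phi> w \<le> (\<Sum>i\<le>k. l i * \<phi> (y i))"
    using S by (simp add: S_def field_simps)
qed

section \<open>Three-operator splitting\<close>

text \<open>In the next two lemmas \<open>dz\<close>, \<open>dA\<close>, \<open>dB\<close>, \<open>dC\<close> are differences, between two points \<open>z\<close>, of
  \<open>z\<close>, \<open>x\<^sub>A\<close>, \<open>x\<^sub>B\<close>, \<open>C x\<^sub>B\<close>; so \<open>dA - dB\<close> is the difference of \<open>T z - z\<close>.\<close>

lemma three_operator_averaged:
  fixes dz dA dB dC :: "'a::real_inner"
  assumes A: "0 \<le> inner dA (2 *\<^sub>R dB - dz - \<gamma> *\<^sub>R dC - dA)"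
    and B: "0 \<le> inner dB (dz - dB)"
    and C: "\<beta> * (norm dC)\<^sup>2 \<le> inner dB dC"
    and pos: "0 < \<epsilon>" "0 < \<gamma>"
  shows "2 * inner dz (dA - dB) \<le> - (2 - \<epsilon>) * (norm (dA - dB))\<^sup>2 - \<gamma> * (2 * \<beta> - \<gamma> / \<epsilon>) * (norm dC)\<^sup>2"
proof -
  define d where "d = dA - dB"
  have dA: "dA = dB + d" by (simp add: d_def)
  \<comment> \<open>In the sum of \<open>A\<close> and \<open>B\<close>, \<open>inner dB dB\<close>
    and \<open>inner dB dz\<close> cancel.\<close>
  have "inner d dz \<le> - (norm d)\<^sup>2 - \<gamma> * inner dB dC - \<gamma> * inner d dC"
    using A B unfolding dA power2_norm_eq_inner
    by (simp add: inner_simps inner_commute algebra_simps)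
  moreover have "\<gamma> * (\<beta> * (norm dC)\<^sup>2) \<le> \<gamma> * inner dB dC"
    using C pos by simp
  \<comment> \<open>Young's inequality with weight \<open>\<epsilon>\<close>: the cross term costs
    \<open>\<gamma>\<^sup>2 / \<epsilon>\<close> times the square of \<open>norm dC\<close>, which
    cocoercivity outweighs when \<open>\<gamma> < 2 * \<beta> * \<epsilon>\<close>.\<close>
  moreover have "0 \<le> \<epsilon> * (norm (d + (\<gamma> / \<epsilon>) *\<^sub>R dC))\<^sup>2"
    using pos by simp
  then have "0 \<le> \<epsilon> * (norm d)\<^sup>2 + 2 * \<gamma> * inner d dC + \<gamma> * (\<gamma> / \<epsilon>) * (norm dC)\<^sup>2"
    using pos unfolding power2_norm_eq_inner
    by (simp add: inner_simps inner_commute algebra_simps)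
  ultimately show ?thesis
    unfolding d_def[symmetric] by (simp add: inner_commute algebra_simps)
qed

text \<open>Expanding the square leaves \<open>l\<^sup>2 * (norm (dA - dB))\<^sup>2\<close>, which
  \<open>l \<le> 2 - \<epsilon>\<close> absorbs into the averagedness term. The \<open>dC\<close>
  term survives and is summed later.\<close>

lemma three_operator_fejer:
  fixes dz dA dB dC :: "'a::real_inner"
  assumes A: "0 \<le> inner dA (2 *\<^sub>R dB - dz - \<gamma> *\<^sub>R dC - dA)"
    and B: "0 \<le> inner dB (dz - dB)"
    and C: "\<beta> * (norm dC)\<^sup>2 \<le> inner dB dC"
    and pos: "0 < \<epsilon>" "0 < \<gamma>" and l: "0 < l" "l \<le> 2 - \<epsilon>"
  shows "(norm (dz + l *\<^sub>R (dA - dB)))\<^sup>2 + l * (\<gamma> * (2 * \<beta> - \<gamma> / \<epsilon>) * (norm dC)\<^sup>2) \<le> (norm dz)\<^sup>2"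
proof -
  define n where "n = (norm (dA - dB))\<^sup>2"
  define m where "m = \<gamma> * (2 * \<beta> - \<gamma> / \<epsilon>) * (norm dC)\<^sup>2"
  have "l * (2 * inner dz (dA - dB)) \<le> l * (- (2 - \<epsilon>) * n - m)"
    using three_operator_averaged[OF A B C pos] l unfolding n_def m_def by simp
  moreover have "(norm (dz + l *\<^sub>R (dA - dB)))\<^sup>2 = (norm dz)\<^sup>2 + l * (2 * inner dz (dA - dB)) + l * (l * n)"
    unfolding n_def power2_norm_eq_inner by (simp add: inner_simps inner_commute algebra_simps)
  moreover have "l * (l * n) \<le> l * ((2 - \<epsilon>) * n)"
    using l by (intro mult_left_mono mult_right_mono) (auto simp: n_def)
  ultimately show ?thesis by (simp add: algebra_simps m_def)
qed

text \<open>Here \<open>uA\<close> and \<open>uB\<close> are full operator values, skew parts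
  included, \<open>c\<close> is the gradient at \<open>xB\<close>, and \<open>c'\<close> is meant to
  be the gradient at the solution. The left-hand side dominates the gap through the subgradient
  inequalities.\<close>

lemma three_operator_gap_step:
  fixes z z' x xA xB uA uB c c' :: "'a::real_inner"
  assumes uB: "\<gamma> *\<^sub>R uB = z - xB" and uA: "\<gamma> *\<^sub>R uA = 2 *\<^sub>R xB - z - \<gamma> *\<^sub>R c - xA"
    and z': "z' = z + l *\<^sub>R (xA - xB)"
    and \<epsilon>: "0 < \<epsilon>" and l: "0 < l" "l \<le> 2 - \<epsilon>"
  shows "2 * \<gamma> * l * (inner (xA - x) uA + inner (xB - x) (uB + c))
    \<le> (norm (z - x))\<^sup>2 - (norm (z' - x))\<^sup>2 + \<gamma>\<^sup>2 / \<epsilon> * (l * (norm (c - c'))\<^sup>2)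
      + 2 * \<gamma> * inner (z - z') c'"
proof -
  define d where "d = xA - xB"
  define e where "e = c - c'"
  have xA: "xA = xB + d" by (simp add: d_def)
  have "\<gamma> * (inner (xA - x) uA + inner (xB - x) (uB + c))
      = inner (xA - x) (\<gamma> *\<^sub>R uA) + inner (xB - x) (\<gamma> *\<^sub>R uB + \<gamma> *\<^sub>R c)"
    by (simp add: inner_simps algebra_simps)
  also have "\<dots> = - inner d (z + d - x) - \<gamma> * inner d c"
    unfolding uA uB xA by (simp add: inner_simps inner_commute algebra_simps)
  finally have "2 * \<gamma> * l * (inner (xA - x) uA + inner (xB - x) (uB + c))
      = 2 * l * (- inner d (z + d - x) - \<gamma> * inner d c)"
    by simp
  \<comment> \<open>With \<open>c = e + c'\<close>, the \<open>c'\<close> part telescopes because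
    \<open>z - z' = - l *\<^sub>R d\<close>.\<close>
  moreover have "2 * l * (- inner d (z + d - x) - \<gamma> * inner d c)
      = (norm (z - x))\<^sup>2 - (norm (z' - x))\<^sup>2 - l * ((2 - l) * (norm d)\<^sup>2)
      - 2 * \<gamma> * l * inner d e + 2 * \<gamma> * inner (z - z') c'"
    unfolding z' d_def[symmetric] e_def power2_norm_eq_inner
    by (simp add: inner_simps inner_commute algebra_simps)
  moreover have "- l * ((2 - l) * (norm d)\<^sup>2) - 2 * \<gamma> * l * inner d e \<le> \<gamma>\<^sup>2 / \<epsilon> * (l * (norm e)\<^sup>2)"
  proof -
    have "0 \<le> \<epsilon> * (norm (d + (\<gamma> / \<epsilon>) *\<^sub>R e))\<^sup>2"
      using \<epsilon> by simp
    then have "0 \<le> \<epsilon> * (norm d)\<^sup>2 + 2 * \<gamma> * inner d e + \<gamma>\<^sup>2 / \<epsilon> * (norm e)\<^sup>2"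
      using \<epsilon> unfolding power2_norm_eq_inner
      by (simp add: inner_simps inner_commute algebra_simps power2_eq_square)
    moreover have "\<epsilon> * (norm d)\<^sup>2 \<le> (2 - l) * (norm d)\<^sup>2"
      using l by (intro mult_right_mono) auto
    ultimately have "0 \<le> l * ((2 - l) * (norm d)\<^sup>2 + 2 * \<gamma> * inner d e + \<gamma>\<^sup>2 / \<epsilon> * (norm e)\<^sup>2)"
      using l by (intro mult_nonneg_nonneg) auto
    then show ?thesis by (simp add: algebra_simps)
  qed
  ultimately show ?thesis unfolding e_def by linarith
qed

theorem corollaryD6:
  fixes f g :: "'a::{real_inner, complete_space} \<Rightarrow> ereal"
    and h :: "'a \<Rightarrow> real"
    and Abar Bbar C T :: "'a \<Rightarrow> 'a"
    and A B :: "'a \<Rightarrow> 'a set"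
    and \<beta> \<epsilon> \<gamma> \<alpha> :: real
    and l :: "nat \<Rightarrow> real"
    and zs xs z0 :: 'a
    and z xA xB xAbar xBbar :: "nat \<Rightarrow> 'a"
  assumes f: "proper_closed_convex f"
    and g: "proper_closed_convex g"
    and h: "proper_closed_convex (\<lambda>x. ereal (h x))"
    and C: "\<And>x. GDERIV h x :> C x"
    and beta: "0 < \<beta>"
    and C_lipschitz: "(1 / \<beta>)-lipschitz_on UNIV C"
    and Abar: "bounded_linear Abar" "adjoint Abar = (\<lambda>x. - Abar x)"
    and Bbar: "bounded_linear Bbar" "adjoint Bbar = (\<lambda>x. - Bbar x)"
    and A: "A = op_add (subdifferential f) (\<lambda>x. {Abar x})" "maximal_monotone A"
    and B: "B = op_add (subdifferential g) (\<lambda>x. {Bbar x})" "maximal_monotone B"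
    and eps: "0 < \<epsilon>" "\<epsilon> < 1"
    and gamma: "0 < \<gamma>" "\<gamma> < 2 * \<beta> * \<epsilon>"
    and alpha: "\<alpha> = 1 / (2 - \<epsilon>)"
    and l: "\<And>j. 0 < l j" "\<And>j. l j \<le> 1 / \<alpha>"
    and T: "\<And>w. T w = w - resolvent (op_scale \<gamma> B) w
              + resolvent (op_scale \<gamma> A)
                  (2 *\<^sub>R resolvent (op_scale \<gamma> B) w - w - \<gamma> *\<^sub>R C (resolvent (op_scale \<gamma> B) w))"
    and fixed_point: "T zs = zs"
    and xs: "xs = resolvent (op_scale \<gamma> B) zs"
    and z_0: "z 0 = z0"
    and z_Suc: "\<And>k. z (Suc k) = (1 - l k) *\<^sub>R z k + l k *\<^sub>R T (z k)"
    and xB: "\<And>k. xB k = resolvent (op_scale \<gamma> B) (z k)"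
    and xA: "\<And>k. xA k = resolvent (op_scale \<gamma> A) (2 *\<^sub>R xB k - z k - \<gamma> *\<^sub>R C (xB k))"
    and xAbar: "\<And>k. xAbar k = (1 / (\<Sum>i\<le>k. l i)) *\<^sub>R (\<Sum>i\<le>k. l i *\<^sub>R xA i)"
    and xBbar: "\<And>k. xBbar k = (1 / (\<Sum>i\<le>k. l i)) *\<^sub>R (\<Sum>i\<le>k. l i *\<^sub>R xB i)"
  shows
    "(\<forall>k. \<forall>x \<in> ext_dom f \<inter> ext_dom g.
        f (xAbar k) + g (xBbar k) + ereal (h (xBbar k)) - (f x + g x + ereal (h x))
          + ereal (inner (- x) (Abar (xBbar k) + Bbar (xBbar k)))
        \<le> ereal (((norm (z0 - x))\<^sup>2 + \<gamma> / (2 * \<beta> * \<epsilon> - \<gamma>) * (norm (z0 - zs))\<^sup>2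
                    + 4 * \<gamma> * norm (z0 - zs) * norm (C xs)
                    + 4 * \<gamma> * onorm Abar * norm x * norm (z0 - zs))
                  / (2 * \<gamma> * (\<Sum>i\<le>k. l i))))
     \<and>
     (\<forall>Lf. ext_lipschitz_on Lf (cball xs ((1 + \<gamma> / \<beta>) * norm (z0 - zs))) f \<longrightarrow>
       (\<forall>k. \<forall>x \<in> ext_dom f \<inter> ext_dom g.
          f (xBbar k) + g (xBbar k) + ereal (h (xBbar k)) - (f x + g x + ereal (h x))
            + ereal (inner (- x) (Abar (xBbar k) + Bbar (xBbar k)))
          \<le> ereal (((norm (z0 - x))\<^sup>2 + \<gamma> / (2 * \<beta> * \<epsilon> - \<gamma>) * (norm (z0 - zs))\<^sup>2
                      + 4 * \<gamma> * norm (z0 - zs) * norm (C xs)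
                      + 4 * \<gamma> * onorm Abar * norm x * norm (z0 - zs)
                      + 4 * \<gamma> * Lf * norm (z0 - zs))
                    / (2 * \<gamma> * (\<Sum>i\<le>k. l i)))))"
proof -

  \<comment> \<open>Cocoercivity, and the resolvents written as inclusions\<close>
  have C_coc: "\<beta> * (norm (C x - C y))\<^sup>2 \<le> inner (x - y) (C x - C y)" for x y
    using convex_gradient_cocoercive[OF _ C beta C_lipschitz] proper_convex_on[OF h]
    by (simp add: ext_dom_def)
  have h_cvx: "convex_on UNIV h"
    using proper_convex_on[OF h] by (simp add: ext_dom_def)
  note skewA = skew_inner_self[OF Abar] and skewB = skew_inner_self[OF Bbar]
  note LA = linear_simps[OF Abar(1)] and LB = linear_simps[OF Bbar(1)]
  define F where "F x = real_of_ereal (f x)" for x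
  define G where "G x = real_of_ereal (g x)" for x
  have F_cvx: "convex_on (ext_dom f) F" and G_cvx: "convex_on (ext_dom g) G"
    unfolding F_def[abs_def] G_def[abs_def] by (intro proper_convex_on f g)+
  define D where "D = norm (z0 - zs)"
  define S where "S k = (\<Sum>i\<le>k. l i)" for k
  have S: "0 < S k" for k unfolding S_def by (rule sum_pos) (use l in auto)
  have l_le: "l k \<le> 2 - \<epsilon>" for k using l(2)[of k] alpha by simp

  obtain uB where uB: "uB k \<in> subdifferential g (xB k)"
      "\<gamma> *\<^sub>R (uB k + Bbar (xB k)) = z k - xB k" for k
    using resolvent_subdifferential_add_skew[OF g Bbar(1) skewB gamma(1) xB[unfolded B(1)]]
    by metis
  obtain uA where uA: "uA k \<in> subdifferential f (xA k)"
      "\<gamma> *\<^sub>R (uA k + Abar (xA k)) = 2 *\<^sub>R xB k - z k - \<gamma> *\<^sub>R C (xB k) - xA k" for k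
    using resolvent_subdifferential_add_skew[OF f Abar(1) skewA gamma(1) xA[unfolded A(1)]]
    by metis
  \<comment> \<open>At a fixed point both resolvents return \<open>xs\<close>, so \<open>xs\<close>
    is the reference point for \<open>xA\<close> as well as for \<open>xB\<close>.\<close>
  have xs': "xs = resolvent (op_scale \<gamma> A) (2 *\<^sub>R xs - zs - \<gamma> *\<^sub>R C xs)"
    using fixed_point unfolding T xs[symmetric] by (simp add: algebra_simps)
  have z_step: "z (Suc k) = z k + l k *\<^sub>R (xA k - xB k)" for k
    unfolding z_Suc T xB[symmetric] xA[symmetric] by (simp add: algebra_simps)
  have firmB: "0 \<le> inner (xB k - xs) (z k - zs - (xB k - xs))" for k
    by (rule resolvent_firmly_nonexpansive[OF g Bbar(1) skewB gamma(1)]) (simp_all add: xB xs B)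
  have firmA: "0 \<le> inner (xA k - xs) (2 *\<^sub>R (xB k - xs) - (z k - zs) - \<gamma> *\<^sub>R (C (xB k) - C xs) - (xA k - xs))" for k
    using resolvent_firmly_nonexpansive[OF f Abar(1) skewA gamma(1) xA[of k, unfolded A(1)] xs'[unfolded A(1)]]
    by (simp add: algebra_simps)

  \<comment> \<open>Fejer monotonicity and its summed consequences\<close>
  define e where "e k = (norm (C (xB k) - C xs))\<^sup>2" for k
  define m where "m = \<gamma> * (2 * \<beta> - \<gamma> / \<epsilon>)"
  have "\<gamma> / \<epsilon> < 2 * \<beta>" using gamma(2) eps(1) by (simp add: field_simps)
  then have m: "0 < m" using gamma(1) by (simp add: m_def)
  have fejer: "(norm (z (Suc k) - zs))\<^sup>2 + m * (l k * e k) \<le> (norm (z k - zs))\<^sup>2" for k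
    using three_operator_fejer[OF firmA firmB C_coc eps(1) gamma(1) l(1) l_le, of k k]
    unfolding z_step e_def m_def by (simp add: algebra_simps)
  have fejer_sum: "(norm (z (Suc k) - zs))\<^sup>2 + m * (\<Sum>i\<le>k. l i * e i) \<le> D\<^sup>2" for k
  proof (induction k)
    case 0
    then show ?case using fejer[of 0] by (simp add: D_def z_0)
  next
    case (Suc k)
    then show ?case using fejer[of "Suc k"] by (simp add: algebra_simps)
  qed
  have sum_e_nonneg: "0 \<le> (\<Sum>i\<le>k. l i * e i)" for k
    using l(1) by (intro sum_nonneg mult_nonneg_nonneg) (auto simp: e_def less_imp_le)
  have z_near: "norm (z k - zs) \<le> D" for k
  proof (cases k)
    case (Suc j)
    then have "(norm (z k - zs))\<^sup>2 \<le> D\<^sup>2"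
      using fejer_sum[of j] mult_nonneg_nonneg[OF less_imp_le[OF m] sum_e_nonneg[of j]] by simp
    then show ?thesis by (rule power2_le_imp_le) (simp add: D_def)
  qed (simp add: D_def z_0)
  \<comment> \<open>This factor 2, times \<open>2 * \<gamma>\<close>, yields the coefficient
    \<open>4 * \<gamma>\<close> of the terms in \<open>norm (C xs)\<close>,
    \<open>onorm Abar\<close> and \<open>Lf\<close>.\<close>
  have z_diff: "norm (z k - z0) \<le> 2 * D" for k
    using norm_triangle_ineq4[of "z k - zs" "z0 - zs"] z_near[of k] by (simp add: D_def)
  have z_sum: "(\<Sum>i\<le>k. l i *\<^sub>R (xA i - xB i)) = z (Suc k) - z0" for k
    by (induction k) (simp_all add: z_step z_0)
  have e_sum: "\<gamma>\<^sup>2 / \<epsilon> * (\<Sum>i\<le>k. l i * e i) \<le> \<gamma> / (2 * \<beta> * \<epsilon> - \<gamma>) * D\<^sup>2" for k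
  proof -
    \<comment> \<open>The identity \<open>m = \<gamma> * (2 * \<beta> * \<epsilon> - \<gamma>) /
      \<epsilon>\<close> is the source of the coefficient
      \<open>\<gamma> / (2 * \<beta> * \<epsilon> - \<gamma>)\<close> in the theorem.\<close>
    have "\<gamma>\<^sup>2 / \<epsilon> = \<gamma> / (2 * \<beta> * \<epsilon> - \<gamma>) * m"
      using gamma eps(1) by (simp add: m_def field_simps power2_eq_square)
    moreover have "m * (\<Sum>i\<le>k. l i * e i) \<le> D\<^sup>2"
      using fejer_sum[of k] zero_le_power2[of "norm (z (Suc k) - zs)"] by linarith
    ultimately show ?thesis
      using mult_left_mono[of "m * (\<Sum>i\<le>k. l i * e i)" "D\<^sup>2" "\<gamma> / (2 * \<beta> * \<epsilon> - \<gamma>)"] gamma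
      by (simp add: mult.assoc)
  qed

  \<comment> \<open>Weighted averages and the gap estimate in real numbers\<close>
  have xA_dom: "xA k \<in> ext_dom f" and xB_dom: "xB k \<in> ext_dom g" for k
    using uA(1) uB(1) subdifferential_iff f g by blast+
  note avgF = convex_on_weighted_average[OF F_cvx xA_dom l(1) xAbar]
    and avgG = convex_on_weighted_average[OF G_cvx xB_dom l(1) xBbar]
    and avgh = convex_on_weighted_average(2)[OF h_cvx UNIV_I l(1) xBbar]
  have S_xBbar: "S k *\<^sub>R xBbar k = (\<Sum>i\<le>k. l i *\<^sub>R xB i)" for k
    using S[of k] by (simp add: xBbar S_def)
  have S_xAbar: "S k *\<^sub>R xAbar k = (\<Sum>i\<le>k. l i *\<^sub>R xA i)" for k
    using S[of k] by (simp add: xAbar S_def)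

  define N where "N x = (norm (z0 - x))\<^sup>2 + \<gamma> / (2 * \<beta> * \<epsilon> - \<gamma>) * D\<^sup>2
      + 4 * \<gamma> * D * norm (C xs) + 4 * \<gamma> * onorm Abar * norm x * D" for x
  \<comment> \<open>The part of the left-hand side shared by both claims, which differ there only in
    the average at which \<open>f\<close> is evaluated.\<close>
  define gap where "gap k x = G (xBbar k) + h (xBbar k) - (F x + G x + h x)
      + inner (- x) (Abar (xBbar k) + Bbar (xBbar k))" for k x
  have gap_le: "F (xAbar k) + gap k x \<le> N x / (2 * \<gamma> * S k)"
    if x: "x \<in> ext_dom f" "x \<in> ext_dom g" for k x
  proof -
    define P where "P i = inner (xA i - x) (uA i + Abar (xA i))
      + inner (xB i - x) ((uB i + Bbar (xB i)) + C (xB i))" for i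
    have P_sum: "2 * \<gamma> * (\<Sum>i\<le>k. l i * P i)
      \<le> (norm (z0 - x))\<^sup>2 - (norm (z (Suc k) - x))\<^sup>2 + \<gamma>\<^sup>2 / \<epsilon> * (\<Sum>i\<le>k. l i * e i)
        + 2 * \<gamma> * inner (z0 - z (Suc k)) (C xs)" for k
    proof -
      have step: "2 * \<gamma> * (l i * P i)
        \<le> (norm (z i - x))\<^sup>2 - (norm (z (Suc i) - x))\<^sup>2 + \<gamma>\<^sup>2 / \<epsilon> * (l i * e i)
          + 2 * \<gamma> * inner (z i - z (Suc i)) (C xs)" for i
        using three_operator_gap_step[OF uB(2) uA(2) z_step eps(1) l(1) l_le, of i x "C xs"]
        unfolding P_def e_def by (simp add: mult.assoc)
      show ?thesis
      proof (induction k)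
        case 0
        then show ?case using step[of 0] by (simp add: z_0)
      next
        case (Suc k)
        then show ?case
          using step[of "Suc k"]
          unfolding sum.atMost_Suc inner_diff_left distrib_left right_diff_distrib by linarith
      qed
    qed
    \<comment> \<open>Skewness reduces \<open>inner (xA i - x) (Abar (xA i))\<close> to
      \<open>inner (- x) (Abar (xA i))\<close>. Splitting \<open>xA i\<close> as
      \<open>xB i + (xA i - xB i)\<close> leaves the term wanted at \<open>xB i\<close> and a
      remainder whose weighted sum is controlled by \<open>z_sum\<close>.\<close>
    have P_ge: "F (xA i) + (G (xB i) + h (xB i)) - (F x + G x + h x)
        + (inner (- x) (Abar (xB i) + Bbar (xB i)) + inner (- x) (Abar (xA i - xB i))) \<le> P i" for i
    proof -
      have "F (xA i) + inner (x - xA i) (uA i) \<le> F x" "G (xB i) + inner (x - xB i) (uB i) \<le> G x"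
        using uA(1)[of i] uB(1)[of i] x
        unfolding F_def G_def subdifferential_iff[OF f] subdifferential_iff[OF g] by blast+
      moreover have "h (xB i) + inner (x - xB i) (C (xB i)) \<le> h x"
        by (rule convex_gradient_le[OF h_cvx C])
      ultimately show ?thesis
        unfolding P_def using skewA[of "xA i"] skewB[of "xB i"] by (simp add: inner_simps LA)
    qed
    have "S k * (F (xAbar k) + gap k x) + inner (- x) (Abar (z (Suc k) - z0))
      \<le> (\<Sum>i\<le>k. l i * (F (xA i) + (G (xB i) + h (xB i)) - (F x + G x + h x)
        + (inner (- x) (Abar (xB i) + Bbar (xB i)) + inner (- x) (Abar (xA i - xB i)))))"
    proof -
      have "S k * inner (- x) (Abar (xBbar k) + Bbar (xBbar k))
          = inner (- x) (Abar (S k *\<^sub>R xBbar k) + Bbar (S k *\<^sub>R xBbar k))"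
        by (simp add: LA LB inner_simps algebra_simps)
      also have "\<dots> = (\<Sum>i\<le>k. l i * inner (- x) (Abar (xB i) + Bbar (xB i)))"
        unfolding S_xBbar linear_sum[OF bounded_linear.linear[OF Abar(1)]]
          linear_sum[OF bounded_linear.linear[OF Bbar(1)]]
        by (simp add: LA LB inner_sum_right inner_simps sum.distrib[symmetric] algebra_simps sum_negf sum_subtractf)
      finally have 1: "S k * inner (- x) (Abar (xBbar k) + Bbar (xBbar k))
          = (\<Sum>i\<le>k. l i * inner (- x) (Abar (xB i) + Bbar (xB i)))" .
      have 2: "inner (- x) (Abar (z (Suc k) - z0)) = (\<Sum>i\<le>k. l i * inner (- x) (Abar (xA i - xB i)))"
        unfolding z_sum[symmetric] linear_sum[OF bounded_linear.linear[OF Abar(1)]]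
        by (simp add: LA(5) inner_sum_right)
      have "S k * F (xAbar k) \<le> (\<Sum>i\<le>k. l i * F (xA i))"
        "S k * G (xBbar k) \<le> (\<Sum>i\<le>k. l i * G (xB i))"
        "S k * h (xBbar k) \<le> (\<Sum>i\<le>k. l i * h (xB i))"
        unfolding S_def by (rule avgF avgG avgh)+
      moreover have "S k * (F x + G x + h x) = (\<Sum>i\<le>k. l i * (F x + G x + h x))"
        by (simp add: S_def sum_distrib_right)
      ultimately show ?thesis
        using 1 2 unfolding gap_def right_diff_distrib distrib_left sum.distrib sum_subtractf
        by linarith
    qed
    also have "\<dots> \<le> (\<Sum>i\<le>k. l i * P i)"
      using l(1) P_ge by (intro sum_mono mult_left_mono) (auto simp: less_imp_le)
    finally have "2 * \<gamma> * (S k * (F (xAbar k) + gap k x) + inner (- x) (Abar (z (Suc k) - z0)))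
        \<le> 2 * \<gamma> * (\<Sum>i\<le>k. l i * P i)"
      using gamma(1) by simp
    moreover have "2 * \<gamma> * inner x (Abar (z (Suc k) - z0)) \<le> 4 * \<gamma> * onorm Abar * norm x * D"
    proof -
      have "inner x (Abar (z (Suc k) - z0)) \<le> norm x * norm (Abar (z (Suc k) - z0))"
        by (rule norm_cauchy_schwarz)
      also have "\<dots> \<le> norm x * (onorm Abar * (2 * D))"
        using onorm[OF Abar(1), of "z (Suc k) - z0"] z_diff[of "Suc k"] onorm_pos_le[OF Abar(1)]
        by (intro mult_left_mono) (auto intro: order_trans mult_left_mono)
      finally have "2 * \<gamma> * inner x (Abar (z (Suc k) - z0)) \<le> 2 * \<gamma> * (norm x * (onorm Abar * (2 * D)))"
        by (rule mult_left_mono) (use gamma(1) in simp)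
      also have "\<dots> = 4 * \<gamma> * onorm Abar * norm x * D" by simp
      finally show ?thesis .
    qed
    moreover have "2 * \<gamma> * inner (z0 - z (Suc k)) (C xs) \<le> 4 * \<gamma> * D * norm (C xs)"
    proof -
      have "inner (z0 - z (Suc k)) (C xs) \<le> norm (z0 - z (Suc k)) * norm (C xs)"
        by (rule norm_cauchy_schwarz)
      also have "\<dots> \<le> (2 * D) * norm (C xs)"
        using z_diff[of "Suc k"] by (intro mult_right_mono) (auto simp: norm_minus_commute)
      finally have "2 * \<gamma> * inner (z0 - z (Suc k)) (C xs) \<le> 2 * \<gamma> * ((2 * D) * norm (C xs))"
        by (rule mult_left_mono) (use gamma(1) in simp)
      also have "\<dots> = 4 * \<gamma> * D * norm (C xs)" by simp
      finally show ?thesis .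
    qed
    ultimately have "2 * \<gamma> * (S k * (F (xAbar k) + gap k x)) \<le> N x"
      using P_sum[of k] e_sum[of k] zero_le_power2[of "norm (z (Suc k) - x)"]
      unfolding N_def distrib_left[of "2 * \<gamma>" "S k * _"] inner_minus_left by linarith
    then show ?thesis
      using gamma(1) S[of k] by (simp add: pos_le_divide_eq mult_ac)
  qed

  \<comment> \<open>Transfer to extended reals and the two claims\<close>
  have fin: "f x = ereal (F x)" if "x \<in> ext_dom f" for x
    using proper_finite[OF f that] by (simp add: F_def)
  have gin: "g x = ereal (G x)" if "x \<in> ext_dom g" for x
    using proper_finite[OF g that] by (simp add: G_def)
  show ?thesis
  proof (intro conjI allI impI ballI)
    fix k x assume x: "x \<in> ext_dom f \<inter> ext_dom g"
    then show "f (xAbar k) + g (xBbar k) + ereal (h (xBbar k)) - (f x + g x + ereal (h x))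
          + ereal (inner (- x) (Abar (xBbar k) + Bbar (xBbar k)))
        \<le> ereal (((norm (z0 - x))\<^sup>2 + \<gamma> / (2 * \<beta> * \<epsilon> - \<gamma>) * (norm (z0 - zs))\<^sup>2
                    + 4 * \<gamma> * norm (z0 - zs) * norm (C xs)
                    + 4 * \<gamma> * onorm Abar * norm x * norm (z0 - zs))
                  / (2 * \<gamma> * (\<Sum>i\<le>k. l i)))"
      using gap_le[of x k] avgF(1)[of k] avgG(1)[of k]
      by (simp add: fin gin gap_def N_def D_def S_def algebra_simps)
  next
    fix Lf k x
    assume Lf: "ext_lipschitz_on Lf (cball xs ((1 + \<gamma> / \<beta>) * norm (z0 - zs))) f"
      and x: "x \<in> ext_dom f \<inter> ext_dom g"
    let ?K = "cball xs ((1 + \<gamma> / \<beta>) * D)"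
    have lip: "Lf-lipschitz_on ?K F"
      using Lf by (simp add: ext_lipschitz_on_def D_def F_def[abs_def])
    \<comment> \<open>Finiteness is part of \<open>ext_lipschitz_on\<close>; it is what makes
      \<open>f (xBbar k)\<close> a real number.\<close>
    have Lf_fin: "w \<in> ext_dom f" if "w \<in> ?K" for w
    proof -
      have "\<bar>f w\<bar> \<noteq> \<infinity>"
        using Lf that unfolding ext_lipschitz_on_def D_def by (elim conjE) (rule bspec)
      then show ?thesis by (auto simp: ext_dom_def)
    qed
    have D: "0 \<le> D" by (simp add: D_def)
    have C_near: "norm (C (xB i) - C xs) \<le> D / \<beta>" and xB_near: "norm (xB i - xs) \<le> D" for i
    proof -
      show *: "norm (xB i - xs) \<le> D"
        using firmly_nonexpansive_norm_le(1)[OF firmB] z_near order_trans by blast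
      show "norm (C (xB i) - C xs) \<le> D / \<beta>"
        using lipschitz_onD[OF C_lipschitz, of "xB i" xs] divide_right_mono[OF *, of \<beta>] beta
        by (simp add: dist_norm)
    qed
    \<comment> \<open>The origin of the radius: the reflected step contributes \<open>D\<close>, the
      gradient step \<open>\<gamma> * (D / \<beta>)\<close>.\<close>
    have xA_near: "norm (xA i - xs) \<le> (1 + \<gamma> / \<beta>) * D" for i
    proof -
      have "norm (xA i - xs) \<le> norm ((2 *\<^sub>R (xB i - xs) - (z i - zs)) - \<gamma> *\<^sub>R (C (xB i) - C xs))"
        using firmly_nonexpansive_norm_le(1)[OF firmA] .
      also have "\<dots> \<le> norm (2 *\<^sub>R (xB i - xs) - (z i - zs)) + norm (\<gamma> *\<^sub>R (C (xB i) - C xs))"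
        by (rule norm_triangle_ineq4)
      also have "\<dots> \<le> D + \<gamma> * (D / \<beta>)"
        using firmly_nonexpansive_norm_le(2)[OF firmB, of i] z_near[of i]
          mult_left_mono[OF C_near[of i], of \<gamma>] gamma(1)
        by (intro add_mono) simp_all
      finally show ?thesis by (simp add: algebra_simps)
    qed
    have "D \<le> (1 + \<gamma> / \<beta>) * D"
      using D beta gamma(1) by (simp add: algebra_simps)
    then have "xB i \<in> ?K" "xA i \<in> ?K" for i
      using xB_near[of i] xA_near[of i] by (auto simp: dist_norm norm_minus_commute)
    \<comment> \<open>The zero function on the ball reduces the averaging lemma to its membership
      part.\<close>
    then have K: "xBbar k \<in> ?K" "xAbar k \<in> ?K"
      using convex_on_weighted_average(1)[of ?K "\<lambda>_. 0", OF _ _ l(1) xBbar]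
        convex_on_weighted_average(1)[of ?K "\<lambda>_. 0", OF _ _ l(1) xAbar]
      by (auto simp: convex_on_def)
    have "xAbar k - xBbar k = (1 / S k) *\<^sub>R (z (Suc k) - z0)"
      unfolding z_sum[symmetric] xAbar xBbar S_def
      by (simp add: scaleR_diff_right sum_subtractf)
    then have "norm (xBbar k - xAbar k) \<le> 2 * D / S k"
      using z_diff[of "Suc k"] S[of k]
      by (simp add: norm_minus_commute[of "xBbar k"] divide_right_mono)
    then have "Lf * norm (xBbar k - xAbar k) \<le> Lf * (2 * D / S k)"
      using lipschitz_on_nonneg[OF lip] by (intro mult_left_mono)
    moreover have "F (xBbar k) - F (xAbar k) \<le> Lf * norm (xBbar k - xAbar k)"
      using lipschitz_onD[OF lip K] by (simp add: dist_norm)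
    moreover have "Lf * (2 * D / S k) = 4 * \<gamma> * Lf * D / (2 * \<gamma> * S k)"
      using gamma(1) by simp
    ultimately have "F (xBbar k) + gap k x \<le> (N x + 4 * \<gamma> * Lf * D) / (2 * \<gamma> * S k)"
      using gap_le[of x k] x by (simp add: add_divide_distrib)
    then show "f (xBbar k) + g (xBbar k) + ereal (h (xBbar k)) - (f x + g x + ereal (h x))
          + ereal (inner (- x) (Abar (xBbar k) + Bbar (xBbar k)))
        \<le> ereal (((norm (z0 - x))\<^sup>2 + \<gamma> / (2 * \<beta> * \<epsilon> - \<gamma>) * (norm (z0 - zs))\<^sup>2
                    + 4 * \<gamma> * norm (z0 - zs) * norm (C xs)
                    + 4 * \<gamma> * onorm Abar * norm x * norm (z0 - zs)
                    + 4 * \<gamma> * Lf * norm (z0 - zs))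
                  / (2 * \<gamma> * (\<Sum>i\<le>k. l i)))"
      using x Lf_fin[OF K(1)] avgG(1)[of k]
      by (simp add: fin gin gap_def N_def D_def S_def algebra_simps)
  qed
qed

end
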